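(* For a non-negative integer $m$ we have $$\gamma_H\left(m,\tfrac12\right)=\gamma_H(m)+2(-1)^m\frac{\log^{m+1}2}{m+1}+2\sum_{k=0}^{m}\binom{m}{k}(-\log 2)^{m-k}\left(\gamma_{\widetilde H}(k)+\gamma_{H^-}(k)\right).$$
   Context: For $a\in\mathbb{C}\setminus\{0,-1,-2,\ldots\}$, let $H_n(a)=\sum_{k=0}^n\frac1{k+a}$ and $\zeta_H(s,a)=\sum_{n=0}^\infty\frac{H_n(a)}{(n+a)^s}$ for $\operatorname{Re}(s)>1$, continued meromorphically in $s$. For $0<a\le1$ the constants $\gamma_H(m,a)$ are defined by the Laurent expansion $\zeta_H(s,a)=\frac{1}{(s-1)^2}+\frac{\gamma(0,a)}{s-1}+\sum_{m=0}^\infty(-1)^m\frac{\gamma_H(m,a)}{m!}(s-1)^m$, $0<|s-1|<1$, where $\gamma(0,a)$ is the constant term in the Laurent expansion at $s=1$ of the Hurwitz zeta function $\zeta(s,a)=\sum_{n=0}^\infty (n+a)^{-s}$; and $\gamma_H(m)=\gamma_H(m,1)$. With $H_n=\sum_{k=1}^n\frac1k$ and the skew harmonic numbers $H_n^-=\sum_{k=1}^n\frac{(-1)^{k-1}}{k}$, the functions $\zeta_{\widetilde H}(s)=\sum_{n=1}^\infty(-1)^{n-1}\frac{H_n}{n^s}$ and $\zeta_{H^-}(s)=\sum_{n=1}^\infty\frac{H_n^-}{n^s}$ (analytically continued) have expansions near $s=1$ $$\zeta_{\widetilde H}(s)=\sum_{m=0}^\infty(-1)^m\frac{\gamma_{\widetilde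 H}(m)}{m!}(s-1)^m,\qquad \zeta_{H^-}(s)=\frac{\log2}{s-1}+\sum_{m=0}^\infty(-1)^m\frac{\gamma_{H^-}(m)}{m!}(s-1)^m,$$ which define $\gamma_{\widetilde H}(m)$ and $\gamma_{H^-}(m)$.
   Formalization: The printed exponent m+1 of log 2 in the middle term is corrected to m+2, since the residue log 2 of the skew function at s=1 supplies one more factor; as printed, the identity fails for every m (for m=0 the sides differ by 2(log 2 − log² 2)). *)

theory Defs
  imports "HOL-Complex_Analysis.Complex_Analysis"
begin

text \<open>
  The meromorphic continuation of a function given on \<open>Re s > 1\<close>. The half-plane \<open>Re s > 0\<close>
  contains the disc \<open>0 < \<bar>s - 1\<bar> < 1\<close> in which the Laurent expansions below are taken. The
  continuation is unique there by the identity theorem (\<open>nicely_meromorphic_on\<close> also fixes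
  the values at removable singularities and poles), so a continuation to a larger
  connected domain has the same Laurent expansion at 1. Outside of the half-plane the
  values are unspecified.
\<close>

definition mero_continuation :: "(complex \<Rightarrow> complex) \<Rightarrow> complex \<Rightarrow> complex" where
  "mero_continuation f =
     (SOME F. F nicely_meromorphic_on {s. Re s > 0} \<and> (\<forall>s. Re s > 1 \<longrightarrow> F s = f s))"

text \<open>
  The constant \<open>c\<close> for which \<open>(- 1) ^ m * c / m!\<close> is the coefficient of \<open>(s - 1) ^ m\<close> in the
  Laurent expansion of \<open>F\<close> at 1.
\<close>

definition laurent_const :: "(complex \<Rightarrow> complex) \<Rightarrow> nat \<Rightarrow> complex" where
  "laurent_const F m = (- 1) ^ m * fact m * fls_nth (laurent_expansion F 1) (int m)"

definition shifted_harm :: "nat \<Rightarrow> complex \<Rightarrow> complex" where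
  "shifted_harm n a = (\<Sum>k=0..n. 1 / (of_nat k + a))"

definition skew_harm :: "nat \<Rightarrow> complex" where
  "skew_harm n = (\<Sum>k=1..n. (- 1) ^ (k - 1) / of_nat k)"

definition zeta_H :: "complex \<Rightarrow> complex \<Rightarrow> complex" where
  "zeta_H a = mero_continuation (\<lambda>s. \<Sum>n. shifted_harm n a / (of_nat n + a) powr s)"

text \<open>In the next two series the index is shifted: \<open>Suc n\<close> runs through \<open>1, 2, 3, \<dots>\<close>.\<close>

definition zeta_H_alt :: "complex \<Rightarrow> complex" where
  "zeta_H_alt = mero_continuation (\<lambda>s. \<Sum>n. (- 1) ^ n * harm (Suc n) / of_nat (Suc n) powr s)"

definition zeta_H_skew :: "complex \<Rightarrow> complex" where
  "zeta_H_skew = mero_continuation (\<lambda>s. \<Sum>n. skew_harm (Suc n) / of_nat (Suc n) powr s)"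

definition gamma_H :: "nat \<Rightarrow> complex \<Rightarrow> complex" where
  "gamma_H m a = laurent_const (zeta_H a) m"

definition gamma_H_alt :: "nat \<Rightarrow> complex" where
  "gamma_H_alt m = laurent_const zeta_H_alt m"

text \<open>
  The product of \<open>2 powr s\<close> with the polar part \<open>ln 2 / (s - 1)\<close> of \<open>zeta_H_skew\<close> contributes
  \<open>2 * (- 1) ^ m * ln 2 ^ (m + 2) / (m + 1)\<close> to the difference of the constants \<open>gamma_H m (1/2)\<close>
  and \<open>gamma_H m 1\<close>. The exponent \<open>m + 1\<close> found in the literature for this term is a misprint:
  for \<open>m = 0\<close> the left-hand side is 4.39508..., and \<open>ln 2\<close> in place of its square gives 4.82047....
\<close>

definition gamma_H_skew :: "nat \<Rightarrow> complex" where
  "gamma_H_skew m = laurent_const zeta_H_skew m"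

end

theory Submission
  imports Defs "HOL-Real_Asymp.Real_Asymp"
begin

text \<open>
  For \<open>Re s > 1\<close>, group the terms of \<open>zeta_H_alt s + zeta_H_skew s\<close> in pairs. Since
  \<open>H\<close> plus \<open>H\<^sup>-\<close> at \<open>2 n + 1\<close> is the shifted harmonic number
  \<open>H n (1/2)\<close>, and \<open>H\<^sup>-\<close> at \<open>2 n\<close> is \<open>H (2 n) - H n\<close>, this gives
  \<open>zeta_H (1/2) s = zeta_H 1 s + 2 powr s * (zeta_H_alt s + zeta_H_skew s)\<close>.
  Summation by parts writes \<open>zeta_H 1\<close>, \<open>zeta_H_skew\<close> and \<open>zeta_H_alt\<close> as functions
  holomorphic on \<open>Re s > 0\<close>, divided by \<open>(s - 1)\<^sup>2\<close>, \<open>s - 1\<close> and 1,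
  respectively. The claim compares the coefficients of these holomorphic functions at 1; the term
  with \<open>ln 2 ^ (m + 2)\<close> comes from the residue \<open>ln 2\<close> of \<open>zeta_H_skew\<close>.
\<close>

section \<open>Growth of the harmonic numbers\<close>

text \<open>The difference of \<open>harm n\<close> and \<open>ln n\<close> converges to Euler's
  constant, hence is bounded. With a logarithm in place of \<open>harm\<close>, limits and growth
  rates are decided by \<open>real_asymp\<close>.\<close>

lemma harm_Suc_le_const_plus_ln:
  obtains K :: real where "K \<ge> 0" "\<And>n. harm (Suc n) \<le> K + ln (real (Suc n))"
proof -
  have "Bseq (\<lambda>n. harm n - ln (real n))"
    using euler_mascheroni_LIMSEQ convergent_imp_Bseq convergentI by blast
  then obtain K where "K > 0" "\<And>n. norm (harm n - ln (real n)) \<le> K"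
    by (auto elim: BseqE)
  from this(1) this(2)[of "Suc _"] show ?thesis
    by (intro that[of K]) (auto simp: abs_le_iff algebra_simps)
qed

lemma summable_harm_powr:
  assumes "e > (0 :: real)"
  shows   "summable (\<lambda>n. harm (Suc n) * real (Suc n) powr (- 1 - e))"
proof -
  obtain K :: real where K: "K \<ge> 0" "\<And>n. harm (Suc n) \<le> K + ln (real (Suc n))"
    using harm_Suc_le_const_plus_ln by blast
  have 1: "summable (\<lambda>n. real (Suc n) powr (- 1 - e / 2))"
    using assms by (subst summable_Suc_iff) (simp add: summable_real_powr_iff)
  \<comment> \<open>Half of \<open>e\<close> absorbs the logarithm; the other half keeps the
    comparison series convergent.\<close>
  have 2: "(\<lambda>n. (K + ln (real (Suc n))) * real (Suc n) powr (- 1 - e))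
                   \<in> O(\<lambda>n. real (Suc n) powr (- 1 - e / 2))"
    using assms by real_asymp
  have "summable (\<lambda>n. (K + ln (real (Suc n))) * real (Suc n) powr (- 1 - e))"
    by (rule summable_comparison_test_bigo[OF _ 2]) (use 1 in simp)
  thus ?thesis
  proof (rule summable_comparison_test'[where N = 0])
    fix n
    show "norm (harm (Suc n) * real (Suc n) powr (- 1 - e))
            \<le> (K + ln (real (Suc n))) * real (Suc n) powr (- 1 - e)"
      using mult_right_mono[OF K(2)[of n], of "real (Suc n) powr (- 1 - e)"]
      by (simp add: abs_mult del: of_nat_Suc)
  qed
qed

lemma tendsto_harm_powr:
  assumes "e > (0 :: real)"
  shows   "(\<lambda>n. harm (Suc n) * real (Suc n) powr (- e)) \<longlonglongrightarrow> 0"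
proof -
  obtain K :: real where K: "K \<ge> 0" "\<And>n. harm (Suc n) \<le> K + ln (real (Suc n))"
    using harm_Suc_le_const_plus_ln by blast
  show ?thesis
  proof (rule tendsto_sandwich[OF _ _ tendsto_const])
    show "(\<lambda>n. (K + ln (real (Suc n))) * real (Suc n) powr (- e)) \<longlonglongrightarrow> 0"
      using assms by real_asymp
    show "\<forall>\<^sub>F n in sequentially. 0 \<le> harm (Suc n) * real (Suc n) powr (- e)"
      by (intro always_eventually allI mult_nonneg_nonneg harm_nonneg powr_ge_zero)
    show "\<forall>\<^sub>F n in sequentially. harm (Suc n) * real (Suc n) powr (- e)
            \<le> (K + ln (real (Suc n))) * real (Suc n) powr (- e)"
      by (intro always_eventually allI mult_right_mono K powr_ge_zero)
  qed
qed

lemma harm_Suc_ge_1: "harm (Suc n) \<ge> (1 :: real)"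
  using harm_mono[of 1 "Suc n", where 'a = real] by (simp add: harm_def)

lemma norm_harm_le: "norm (harm (Suc n) :: complex) \<le> harm (Suc n)"
  by (simp only: norm_harm)

lemma norm_of_nat_powr: "norm ((of_nat n :: complex) powr s) = real n powr Re s"
  by (simp add: norm_powr_real_powr)

section \<open>Differences of complex powers\<close>

text \<open>The mean value inequality on a segment of length 1 gives the first bound, Taylor's
  formula of order one for \<open>z powr (1 - s)\<close> the second. The decay
  \<open>x powr (- 1 - Re s)\<close> is summable for \<open>Re s > 0\<close> even with a logarithmic
  factor.\<close>

lemma powr_secant_bounds:
  fixes s :: complex and x :: real
  assumes "x > 0" "Re s > 0"
  shows   "norm (of_real x powr (- s) - of_real (x + 1) powr (- s)) \<le> norm s * x powr (- 1 - Re s)"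
    and   "norm ((s - 1) * of_real x powr (- s) - of_real x powr (1 - s) + of_real (x + 1) powr (1 - s))
             \<le> norm s * norm (s - 1) * x powr (- 1 - Re s)"
proof -
  define S :: "complex set" where "S = of_real ` {x..x+1}"
  have S_eq: "S = closed_segment (of_real x) (of_real (x + 1))"
    unfolding S_def by (subst closed_segment_of_real) (simp add: closed_segment_eq_real_ivl)
  have S: "convex S" unfolding S_eq by simp
  have mem: "of_real x \<in> S" "of_real (x + 1) \<in> S"
    unfolding S_def by (auto simp del: of_real_add)
  have nonpos: "z \<notin> \<real>\<^sub>\<le>\<^sub>0" if "z \<in> S" for z
    using that assms by (auto simp: S_def)
  have deriv: "((\<lambda>z. z powr a) has_field_derivative (a * z powr (a - 1))) (at z within S)"
    if "z \<in> S" for z a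
    using has_field_derivative_powr[OF nonpos[OF that]] by (rule has_field_derivative_at_within)
  have bound: "norm (z powr (- s - 1)) \<le> x powr (- 1 - Re s)" if z: "z \<in> S" for z
  proof -
    from z obtain t where t: "z = of_real t" "t \<ge> x" by (auto simp: S_def)
    have "norm (z powr (- s - 1)) = t powr (- Re s - 1)"
      using t assms by (simp add: norm_powr_real_powr)
    also have "- Re s - 1 = - 1 - Re s"
      by simp
    also have "t powr (- 1 - Re s) \<le> x powr (- 1 - Re s)"
      using t assms by (intro powr_mono2') auto
    finally show ?thesis .
  qed
  have "norm (of_real x powr (- s) - of_real (x + 1) powr (- s))
          \<le> norm s * x powr (- 1 - Re s) * norm (of_real x - of_real (x + 1) :: complex)"
    by (rule field_differentiable_bound[OF S deriv _ mem])
       (auto simp: norm_mult intro!: mult_left_mono bound)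
  thus "norm (of_real x powr (- s) - of_real (x + 1) powr (- s)) \<le> norm s * x powr (- 1 - Re s)"
    by simp

  \<comment> \<open>The function \<open>z powr (1 - s)\<close> and its first two derivatives,
    indexed as \<open>complex_Taylor\<close> expects; the remainder after the linear term is the
    expression in the second bound.\<close>
  define f :: "nat \<Rightarrow> complex \<Rightarrow> complex" where
    "f = (\<lambda>i z. if i = 0 then z powr (1 - s) else if i = 1 then (1 - s) * z powr (- s)
                else (1 - s) * (- s) * z powr (- s - 1))"
  have "norm (f 0 (of_real (x + 1)) - (\<Sum>i\<le>1. f i (of_real x) * (of_real (x + 1) - of_real x) ^ i / fact i))
          \<le> (norm s * norm (s - 1) * x powr (- 1 - Re s))
              * norm (of_real (x + 1) - of_real x :: complex) ^ Suc 1 / fact 1"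
  proof (rule complex_Taylor[OF S _ _ mem])
    fix i :: nat and z assume z: "z \<in> S" and i: "i \<le> 1"
    have "((\<lambda>z. (1 - s) * z powr (- s)) has_field_derivative
             (1 - s) * (- s * z powr (- s - 1))) (at z within S)"
      by (intro DERIV_cmult deriv z)
    with deriv[OF z, of "1 - s"] i show "(f i has_field_derivative f (Suc i) z) (at z within S)"
      by (cases "i = 0") (auto simp: f_def mult_ac)
  next
    fix z assume "z \<in> S"
    have "norm (f (Suc 1) z) = norm s * norm (s - 1) * norm (z powr (- s - 1))"
      by (simp add: f_def norm_mult norm_minus_commute[of 1 s])
    also have "\<dots> \<le> norm s * norm (s - 1) * x powr (- 1 - Re s)"
      using bound[OF \<open>z \<in> S\<close>] by (rule mult_left_mono) simp
    finally show "norm (f (Suc 1) z) \<le> norm s * norm (s - 1) * x powr (- 1 - Re s)" .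
  qed
  thus "norm ((s - 1) * of_real x powr (- s) - of_real x powr (1 - s) + of_real (x + 1) powr (1 - s))
             \<le> norm s * norm (s - 1) * x powr (- 1 - Re s)"
    by (simp add: f_def algebra_simps)
qed

section \<open>Holomorphic series with harmonic majorants\<close>

text \<open>A locally uniform summable majorant suffices, by Weierstrass. The factor
  \<open>(1 + norm s)\<^sup>2\<close> is large enough for both the kernel series and the alternating
  series below.\<close>

lemma
  fixes f :: "nat \<Rightarrow> complex \<Rightarrow> complex"
  assumes hol: "\<And>n. f n holomorphic_on {s. Re s > 0}"
    and bound: "\<And>n s. Re s > 0 \<Longrightarrow>
           norm (f n s) \<le> (1 + norm s)\<^sup>2 * (harm (Suc n) * real (Suc n) powr (- 1 - Re s))"
  shows holomorphic_harm_dominated_series: "(\<lambda>s. \<Sum>n. f n s) holomorphic_on {s. Re s > 0}"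
    and summable_harm_dominated_series: "\<And>s. Re s > 0 \<Longrightarrow> summable (\<lambda>n. f n s)"
proof -
  have op: "open {s :: complex. Re s > 0}" by (rule open_halfspace_Re_gt)
  have "\<exists>g g'. \<forall>s\<in>{s. Re s > 0}. (\<lambda>n. f n s) sums g s \<and> (\<lambda>n. deriv (f n) s) sums g' s
            \<and> (g has_field_derivative g' s) (at s)"
  proof (rule series_and_derivative_comparison_local[OF op])
    show "(f n has_field_derivative deriv (f n) s) (at s)" if "s \<in> {s. Re s > 0}" for n s
      using holomorphic_derivI[OF hol op that] .
  next
    fix s :: complex assume s: "s \<in> {s. Re s > 0}"
    define h where "h = (\<lambda>n. (1 + (norm s + Re s / 2))\<^sup>2 *
                              (harm (Suc n) * real (Suc n) powr (- 1 - Re s / 2)))"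
    have "norm (f n z) \<le> h n" if z: "z \<in> ball s (Re s / 2)" for n z
    proof -
      have "\<bar>Re s - Re z\<bar> \<le> norm (s - z)" using abs_Re_le_cmod[of "s - z"] by simp
      with z have Re: "Re z > Re s / 2" by (auto simp: dist_norm)
      have nz: "norm z \<le> norm s + Re s / 2"
        using z norm_triangle_sub[of z s] by (auto simp: dist_norm norm_minus_commute)
      have "norm (f n z) \<le> (1 + norm z)\<^sup>2 * (harm (Suc n) * real (Suc n) powr (- 1 - Re z))"
        using Re s by (intro bound) auto
      also have "\<dots> \<le> h n"
        unfolding h_def using nz Re
        by (intro mult_mono power_mono powr_mono add_mono) (auto simp: harm_nonneg)
      finally show ?thesis .
    qed
    moreover have "summable h"
      unfolding h_def using s by (intro summable_mult summable_harm_powr) auto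
    ultimately show "\<exists>d h. 0 < d \<and> summable h \<and>
        (\<forall>\<^sub>F n in sequentially. \<forall>y\<in>ball s d \<inter> {s. 0 < Re s}. norm (f n y) \<le> h n)"
      using s by (intro exI[of _ "Re s / 2"] exI[of _ h]) auto
  qed
  then obtain g g' where g: "\<And>s. Re s > 0 \<Longrightarrow> (\<lambda>n. f n s) sums g s"
      "\<And>s. Re s > 0 \<Longrightarrow> (g has_field_derivative g' s) (at s)"
    by blast
  show "summable (\<lambda>n. f n s)" if "Re s > 0" for s
    using g(1)[OF that] by (rule sums_summable)
  have "g holomorphic_on {s. Re s > 0}"
    using g(2) by (auto simp: holomorphic_on_open[OF op])
  also have "?this \<longleftrightarrow> (\<lambda>s. \<Sum>n. f n s) holomorphic_on {s. Re s > 0}"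
    using g(1) by (intro holomorphic_cong) (auto simp: sums_iff)
  finally show "(\<lambda>s. \<Sum>n. f n s) holomorphic_on {s. Re s > 0}" .
qed

section \<open>Continuation of Dirichlet series to \<open>Re s > 0\<close>\<close>

text \<open>
  The first-order Taylor remainder of \<open>x powr (1 - s)\<close> on \<open>[n + 1, n + 2]\<close>. It is
  \<open>O(n powr (- 1 - Re s))\<close>, so weighting it with the partial sums of \<open>c\<close> continues
  the Dirichlet series of these partial sums to \<open>Re s > 0\<close>.
\<close>

definition powr_kernel :: "nat \<Rightarrow> complex \<Rightarrow> complex" where
  "powr_kernel n s = (s - 1) * of_nat (Suc n) powr (- s)
                     - of_nat (Suc n) powr (1 - s) + of_nat (Suc (Suc n)) powr (1 - s)"

definition kernel_series :: "(nat \<Rightarrow> complex) \<Rightarrow> complex \<Rightarrow> complex" where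
  "kernel_series c s = (\<Sum>n. (\<Sum>k\<le>n. c k) * powr_kernel n s)"

text \<open>
  Adding an alternating series to its own shift doubles the sum up to the first term and
  turns the terms into differences.
\<close>

definition alt_term :: "(nat \<Rightarrow> complex) \<Rightarrow> nat \<Rightarrow> complex \<Rightarrow> complex" where
  "alt_term d n s =
     (- 1) ^ n * (d n * of_nat (Suc n) powr (- s) - d (Suc n) * of_nat (Suc (Suc n)) powr (- s))"

definition alt_series :: "(nat \<Rightarrow> complex) \<Rightarrow> complex \<Rightarrow> complex" where
  "alt_series d s = (d 0 + (\<Sum>n. alt_term d n s)) / 2"

lemma norm_sum_le_harm:
  fixes c :: "nat \<Rightarrow> complex"
  assumes "\<And>n. norm (c n) \<le> 1 / real (Suc n)"
  shows   "norm (\<Sum>k\<le>n. c k) \<le> harm (Suc n)"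
proof -
  have "norm (\<Sum>k\<le>n. c k) \<le> (\<Sum>k\<le>n. 1 / real (Suc k))"
    by (intro sum_norm_le assms)
  also have "\<dots> = harm (Suc n)"
    by (simp only: harm_altdef lessThan_Suc_atMost) (simp add: field_simps)
  finally show ?thesis .
qed

lemma
  assumes c: "\<And>n. norm (c n) \<le> 1 / real (Suc n)"
  shows holomorphic_kernel_series: "kernel_series c holomorphic_on {s. Re s > 0}"
    and summable_kernel_series:
      "\<And>s. Re s > 0 \<Longrightarrow> summable (\<lambda>n. (\<Sum>k\<le>n. c k) * powr_kernel n s)"
proof -
  have hol: "(\<lambda>s. (\<Sum>k\<le>n. c k) * powr_kernel n s) holomorphic_on {s. Re s > 0}" for n
    unfolding powr_kernel_def by (intro holomorphic_intros)
  have bound: "norm ((\<Sum>k\<le>n. c k) * powr_kernel n s)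
      \<le> (1 + norm s)\<^sup>2 * (harm (Suc n) * real (Suc n) powr (- 1 - Re s))" if s: "Re s > 0" for n s
  proof -
    have "norm (powr_kernel n s) \<le> norm s * norm (s - 1) * real (Suc n) powr (- 1 - Re s)"
      using powr_secant_bounds(2)[of "real (Suc n)" s] s by (simp add: powr_kernel_def add_ac)
    also have "\<dots> \<le> (1 + norm s) * (1 + norm s) * real (Suc n) powr (- 1 - Re s)"
      using norm_triangle_ineq4[of s 1] by (intro mult_mono) auto
    finally have "norm (powr_kernel n s) \<le> (1 + norm s)\<^sup>2 * real (Suc n) powr (- 1 - Re s)"
      by (simp add: power2_eq_square)
    with norm_sum_le_harm[OF c, of n] have
      "norm (\<Sum>k\<le>n. c k) * norm (powr_kernel n s)
         \<le> harm (Suc n) * ((1 + norm s)\<^sup>2 * real (Suc n) powr (- 1 - Re s))"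
      by (intro mult_mono) (auto simp: harm_nonneg)
    thus ?thesis by (simp only: norm_mult mult_ac)
  qed
  show "kernel_series c holomorphic_on {s. Re s > 0}"
    unfolding kernel_series_def by (rule holomorphic_harm_dominated_series[OF hol bound])
  show "summable (\<lambda>n. (\<Sum>k\<le>n. c k) * powr_kernel n s)" if "Re s > 0" for s
    by (rule summable_harm_dominated_series[OF hol bound that])
qed

text \<open>The hypotheses cover constant coefficients 1 and harmonic numbers, the two cases that
  occur.\<close>

lemma holomorphic_alt_series:
  assumes d: "\<And>n. norm (d n) \<le> harm (Suc n)" "\<And>n. norm (d (Suc n) - d n) \<le> 1 / real (Suc (Suc n))"
  shows "alt_series d holomorphic_on {s. Re s > 0}"
proof -
  have hol: "alt_term d n holomorphic_on {s. Re s > 0}" for n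
    unfolding alt_term_def by (intro holomorphic_intros)
  have bound: "norm (alt_term d n s)
      \<le> (1 + norm s)\<^sup>2 * (harm (Suc n) * real (Suc n) powr (- 1 - Re s))" if s: "Re s > 0" for n s
  proof -
    let ?h = "harm (Suc n) :: real" and ?p = "real (Suc n) powr (- 1 - Re s)"
    let ?N = "of_nat (Suc n) :: complex" and ?N' = "of_nat (Suc (Suc n)) :: complex"
    \<comment> \<open>Discrete product rule: one summand varies the power, the other the
      coefficient, and either variation gains a factor of order \<open>1 / n\<close>.\<close>
    have "norm (alt_term d n s) = norm (d n * (?N powr (- s) - ?N' powr (- s))
                                        - (d (Suc n) - d n) * ?N' powr (- s))"
      unfolding alt_term_def norm_mult norm_power by (simp add: algebra_simps del: of_nat_Suc)
    also have "\<dots> \<le> norm (d n) * norm (?N powr (- s) - ?N' powr (- s))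
                    + norm (d (Suc n) - d n) * norm (?N' powr (- s))"
      by (rule order.trans[OF norm_triangle_ineq4]) (simp add: norm_mult)
    also have "\<dots> \<le> ?h * (norm s * ?p) + ?h * ?p"
    proof (rule add_mono)
      show "norm (d n) * norm (?N powr (- s) - ?N' powr (- s)) \<le> ?h * (norm s * ?p)"
        using powr_secant_bounds(1)[of "real (Suc n)" s] s d(1)[of n]
        by (intro mult_mono) (auto simp: harm_nonneg add_ac)
      have "norm (d (Suc n) - d n) * norm (?N' powr (- s))
              \<le> 1 / real (Suc (Suc n)) * real (Suc (Suc n)) powr (- Re s)"
        using d(2)[of n] by (intro mult_mono) (auto simp: norm_of_nat_powr simp del: of_nat_Suc)
      also have "\<dots> = real (Suc (Suc n)) powr (- 1 - Re s)"
        by (simp add: powr_diff powr_minus field_simps del: of_nat_Suc)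
      also have "\<dots> \<le> ?p"
        using s by (intro powr_mono2') auto
      also have "\<dots> \<le> ?h * ?p"
        using mult_right_mono[OF harm_Suc_ge_1[of n], of ?p] by simp
      finally show "norm (d (Suc n) - d n) * norm (?N' powr (- s)) \<le> ?h * ?p" .
    qed
    also have "\<dots> = (1 + norm s) * (?h * ?p)" by (simp add: algebra_simps)
    also have "\<dots> \<le> (1 + norm s)\<^sup>2 * (?h * ?p)"
      using self_le_power[of "1 + norm s" 2]
      by (intro mult_right_mono mult_nonneg_nonneg) (auto simp: harm_nonneg)
    finally show ?thesis .
  qed
  show "alt_series d holomorphic_on {s. Re s > 0}"
    unfolding alt_series_def
    by (intro holomorphic_intros holomorphic_harm_dominated_series[OF hol bound]) auto
qed

text \<open>The shifted series sums to \<open>S - d 0\<close>, so the terms \<open>alt_term\<close>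
  sum to \<open>2 * S - d 0\<close>. Mere convergence is enough, which allows \<open>s = 1\<close>,
  where the series for \<open>ln 2\<close> converges only conditionally.\<close>

lemma alt_series_eqI:
  assumes "(\<lambda>n. (- 1) ^ n * d n * of_nat (Suc n) powr (- s)) sums S"
  shows   "alt_series d s = S"
proof -
  let ?f = "\<lambda>n. (- 1) ^ n * d n * of_nat (Suc n) powr (- s)"
  have "(\<lambda>n. ?f (Suc n)) sums (S - d 0)"
    using assms by (subst sums_Suc_iff) simp
  from sums_add[OF assms this] have "(\<lambda>n. alt_term d n s) sums (S + (S - d 0))"
    by (simp add: alt_term_def algebra_simps)
  thus ?thesis by (simp add: alt_series_def sums_iff)
qed

lemma summable_harm_dominated:
  fixes b :: "nat \<Rightarrow> complex"
  assumes "\<And>n. norm (b n) \<le> harm (Suc n)" "Re s > 1"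
  shows   "summable (\<lambda>n. b n * of_nat (Suc n) powr (- s))"
proof (rule summable_comparison_test'[where N = 0])
  show "summable (\<lambda>n. harm (Suc n) * real (Suc n) powr (- 1 - (Re s - 1)))"
    using assms by (intro summable_harm_powr) auto
  show "norm (b n * of_nat (Suc n) powr (- s)) \<le> harm (Suc n) * real (Suc n) powr (- 1 - (Re s - 1))" for n
    using assms(1)[of n] by (simp add: norm_mult norm_of_nat_powr mult_right_mono del: of_nat_Suc)
qed

text \<open>Summation by parts: up to a holomorphic correction, a factor \<open>s - 1\<close> trades
  the Dirichlet series of the partial sums for that of the coefficients, with the exponent shifted
  by one.\<close>

lemma kernel_series_eq:
  fixes c :: "nat \<Rightarrow> complex"
  assumes c: "\<And>n. norm (c n) \<le> 1 / real (Suc n)" and s: "Re s > 1"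
  shows "(s - 1) * (\<Sum>n. (\<Sum>k\<le>n. c k) * of_nat (Suc n) powr (- s))
           = (\<Sum>n. c n * of_nat (Suc n) powr (1 - s)) + kernel_series c s"
proof -
  let ?C = "\<lambda>n. \<Sum>k\<le>n. c k"
  define v where "v = (\<lambda>n. (\<Sum>k<n. c k) * of_nat (Suc n) powr (1 - s))"
  have v_lim: "v \<longlonglongrightarrow> 0"
  proof (rule Lim_null_comparison)
    show "(\<lambda>n. harm (Suc n) * real (Suc n) powr (- (Re s - 1))) \<longlonglongrightarrow> 0"
      using s by (intro tendsto_harm_powr) auto
    have "norm (\<Sum>k<n. c k) \<le> harm (Suc n)" for n
      using norm_sum_le_harm[OF c, of "n - 1"] harm_mono[of n "Suc n", where 'a = real] 
      by (cases n) (auto simp: lessThan_Suc_atMost harm_nonneg simp del: sum.atMost_Suc)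
    thus "\<forall>\<^sub>F n in sequentially. norm (v n) \<le> harm (Suc n) * real (Suc n) powr (- (Re s - 1))"
      by (auto simp: v_def norm_mult norm_of_nat_powr intro!: mult_right_mono simp del: of_nat_Suc)
  qed
  have "(\<lambda>n. v (Suc n) - v n) sums (0 - v 0)"
    by (rule telescope_sums) fact
  hence v: "(\<lambda>n. v (Suc n) - v n) sums 0" by (simp add: v_def)
  have 1: "(\<lambda>n. ?C n * powr_kernel n s) sums kernel_series c s"
    unfolding kernel_series_def using summable_kernel_series[OF c, of s] s by (simp add: summable_sums)
  have 2: "(\<lambda>n. (s - 1) * (?C n * of_nat (Suc n) powr (- s)))
             sums ((s - 1) * (\<Sum>n. ?C n * of_nat (Suc n) powr (- s)))"
    by (intro sums_mult summable_sums summable_harm_dominated norm_sum_le_harm c s)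
  have eq: "(s - 1) * (?C n * of_nat (Suc n) powr (- s)) - ?C n * powr_kernel n s + (v (Suc n) - v n)
         = c n * of_nat (Suc n) powr (1 - s)" for n
  proof -
    have C: "?C n = (\<Sum>k<n. c k) + c n" "(\<Sum>k<Suc n. c k) = (\<Sum>k<n. c k) + c n"
      by (simp_all flip: lessThan_Suc_atMost)
    show ?thesis
      unfolding powr_kernel_def v_def C by (simp add: algebra_simps del: of_nat_Suc)
  qed
  have "(\<lambda>n. c n * of_nat (Suc n) powr (1 - s))
          sums ((s - 1) * (\<Sum>n. ?C n * of_nat (Suc n) powr (- s)) - kernel_series c s + 0)"
    using sums_add[OF sums_diff[OF 2 1] v] by (simp only: eq)
  from sums_unique[OF this] show ?thesis
    by (simp only: add_0_right diff_eq_eq)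
qed

section \<open>Numerators of the three zeta functions\<close>

text \<open>All partial sums are 1, so summation by parts also treats the Riemann zeta
  function.\<close>

definition delta_coeff :: "nat \<Rightarrow> complex" where
  "delta_coeff n = (if n = 0 then 1 else 0)"

definition harm_coeff :: "nat \<Rightarrow> complex" where
  "harm_coeff n = 1 / of_nat (Suc n)"

definition skew_coeff :: "nat \<Rightarrow> complex" where
  "skew_coeff n = (- 1) ^ n / of_nat (Suc n)"

lemma norm_coeff_le:
  "norm (delta_coeff n) \<le> 1 / real (Suc n)"
  "norm (harm_coeff n) \<le> 1 / real (Suc n)"
  "norm (skew_coeff n) \<le> 1 / real (Suc n)"
  by (simp_all add: delta_coeff_def harm_coeff_def skew_coeff_def norm_divide norm_power
                    del: of_nat_Suc)

lemma sum_delta_coeff: "(\<Sum>k\<le>n. delta_coeff k) = 1"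
  by (simp add: delta_coeff_def)

lemma sum_harm_coeff: "(\<Sum>k\<le>n. harm_coeff k) = harm (Suc n)"
  by (simp only: harm_altdef lessThan_Suc_atMost) (simp add: harm_coeff_def field_simps)

lemma skew_harm_Suc: "skew_harm (Suc n) = skew_harm n + (- 1) ^ n / of_nat (Suc n)"
  by (simp add: skew_harm_def)

lemma sum_skew_coeff: "(\<Sum>k\<le>n. skew_coeff k) = skew_harm (Suc n)"
  by (induction n) (simp_all add: skew_harm_Suc skew_coeff_def, simp_all add: skew_harm_def)

lemma coeff_mult_powr:
  "1 / of_nat (Suc n) * of_nat (Suc n) powr (1 - s) = (of_nat (Suc n) :: complex) powr (- s)"
proof -
  have "(of_nat (Suc n) :: complex) \<noteq> 0" by (simp del: of_nat_Suc)
  thus ?thesis by (simp add: powr_diff powr_minus field_simps del: of_nat_Suc)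
qed

text \<open>The continuation of \<open>(s - 1) ^ 2 * zeta_H 1 s\<close>; the first two summands make
  up \<open>s - 1\<close> times the Riemann zeta function.\<close>

definition P_H :: "complex \<Rightarrow> complex" where
  "P_H s = 1 + kernel_series delta_coeff s + (s - 1) * kernel_series harm_coeff s"

text \<open>The continuation of \<open>(s - 1) * zeta_H_skew s\<close>; the first summand is the
  Dirichlet eta function.\<close>

definition P_skew :: "complex \<Rightarrow> complex" where
  "P_skew s = alt_series (\<lambda>_. 1) s + kernel_series skew_coeff s"

definition P_alt :: "complex \<Rightarrow> complex" where
  "P_alt = alt_series (\<lambda>n. harm (Suc n))"

lemma holomorphic_numerators:
  "P_H holomorphic_on {s. Re s > 0}"
  "P_skew holomorphic_on {s. Re s > 0}"
  "P_alt holomorphic_on {s. Re s > 0}"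
proof -
  note K = norm_coeff_le[THEN holomorphic_kernel_series]
  show "P_H holomorphic_on {s. Re s > 0}"
    unfolding P_H_def
    by (intro holomorphic_on_add holomorphic_on_mult holomorphic_on_diff holomorphic_on_const
          holomorphic_on_ident K)
  have "alt_series (\<lambda>_. 1) holomorphic_on {s. Re s > 0}"
    by (rule holomorphic_alt_series) (simp_all add: harm_Suc_ge_1)
  thus "P_skew holomorphic_on {s. Re s > 0}"
    unfolding P_skew_def by (intro holomorphic_on_add K)
  show "P_alt holomorphic_on {s. Re s > 0}"
    unfolding P_alt_def
  proof (rule holomorphic_alt_series)
    show "norm (harm (Suc n) :: complex) \<le> harm (Suc n)" for n
      by (rule norm_harm_le)
    show "norm (harm (Suc (Suc n)) - harm (Suc n) :: complex) \<le> 1 / real (Suc (Suc n))" for n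
      by (simp only: harm_Suc[of "Suc n"] add_diff_cancel_left' inverse_eq_divide norm_divide
            norm_one norm_of_nat order_refl)
  qed
qed

text \<open>This value is the residue of \<open>zeta_H_skew\<close> at 1.\<close>

lemma P_skew_1: "P_skew 1 = of_real (ln 2)"
proof -
  have "(\<lambda>n. of_real ((- 1) ^ n / real (Suc n)) :: complex) sums of_real (ln 2)"
    by (intro sums_of_real alternating_harmonic_series_sums)
  hence "(\<lambda>n. (- 1) ^ n * 1 * of_nat (Suc n) powr (- 1) :: complex) sums of_real (ln 2)"
    by (simp add: powr_minus field_simps)
  hence "alt_series (\<lambda>_. 1) 1 = of_real (ln 2)"
    by (rule alt_series_eqI)
  \<comment> \<open>At \<open>s = 1\<close> both powers with exponent \<open>1 - s\<close> equal 1,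
    so every kernel vanishes.\<close>
  moreover have "kernel_series skew_coeff 1 = 0"
    by (simp add: kernel_series_def powr_kernel_def del: of_nat_Suc)
  ultimately show ?thesis by (simp add: P_skew_def)
qed

lemma norm_skew_harm_le: "norm (skew_harm (Suc n)) \<le> harm (Suc n)"
  using norm_sum_le_harm[OF norm_coeff_le(3), of n] by (simp only: sum_skew_coeff)

text \<open>For \<open>harm\<close>, summation by parts is applied twice, first down to the Riemann
  zeta function and then to the constant 1, whence the square. For \<open>skew_harm\<close> one
  application leads to the eta function. The last series already alternates.\<close>

lemma
  fixes s :: complex
  assumes s: "Re s > 1"
  shows sums_harm: "(\<lambda>n. harm (Suc n) / of_nat (Suc n) powr s) sums (P_H s / (s - 1) ^ 2)"
    and sums_skew: "(\<lambda>n. skew_harm (Suc n) / of_nat (Suc n) powr s) sums (P_skew s / (s - 1))"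
    and sums_alt: "(\<lambda>n. (- 1) ^ n * harm (Suc n) / of_nat (Suc n) powr s) sums P_alt s"
proof -
  note div = divide_inverse powr_minus[symmetric]
  from s have s1: "s - 1 \<noteq> 0" by auto
  have "(\<lambda>n. delta_coeff n * of_nat (Suc n) powr (1 - s)) = (\<lambda>n. if n = 0 then 1 else 0)"
    by (auto simp: delta_coeff_def)
  hence "(\<Sum>n. delta_coeff n * of_nat (Suc n) powr (1 - s)) = 1"
    using sums_unique[OF sums_single[of 0 "\<lambda>_. 1 :: complex"]] by simp
  with kernel_series_eq[OF norm_coeff_le(1) s]
  have zeta: "(s - 1) * (\<Sum>n. of_nat (Suc n) powr (- s)) = 1 + kernel_series delta_coeff s"
    by (simp only: sum_delta_coeff mult_1)
  have c: "harm_coeff n * of_nat (Suc n) powr (1 - s) = of_nat (Suc n) powr (- s)" for n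
    unfolding harm_coeff_def by (rule coeff_mult_powr)
  have H: "(s - 1) * (\<Sum>n. harm (Suc n) * of_nat (Suc n) powr (- s))
             = (\<Sum>n. of_nat (Suc n) powr (- s)) + kernel_series harm_coeff s"
    using kernel_series_eq[OF norm_coeff_le(2) s]
    by (simp only: sum_harm_coeff c)
  have "(s - 1) ^ 2 * (\<Sum>n. harm (Suc n) * of_nat (Suc n) powr (- s))
          = (s - 1) * ((s - 1) * (\<Sum>n. harm (Suc n) * of_nat (Suc n) powr (- s)))"
    by (simp only: power2_eq_square mult.assoc)
  also have "\<dots> = P_H s"
    unfolding H by (simp only: distrib_left zeta P_H_def)
  finally have "(\<Sum>n. harm (Suc n) * of_nat (Suc n) powr (- s)) = P_H s / (s - 1) ^ 2"
    using s1 by (simp add: field_simps del: of_nat_Suc)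
  moreover have "summable (\<lambda>n. harm (Suc n) * of_nat (Suc n) powr (- s) :: complex)"
    by (intro summable_harm_dominated norm_harm_le s)
  ultimately show "(\<lambda>n. harm (Suc n) / of_nat (Suc n) powr s) sums (P_H s / (s - 1) ^ 2)"
    by (simp only: sums_iff div simp_thms)

  have "summable (\<lambda>n. (- 1) ^ n * of_nat (Suc n) powr (- s) :: complex)"
    by (intro summable_harm_dominated s) (use harm_Suc_ge_1 in \<open>simp add: norm_power\<close>)
  hence "(\<lambda>n. (- 1) ^ n * 1 * of_nat (Suc n) powr (- s)) sums (\<Sum>n. (- 1) ^ n * of_nat (Suc n) powr (- s))"
    by (simp only: mult_1_right summable_sums)
  from alt_series_eqI[OF this] 
  have eta: "(\<Sum>n. (- 1) ^ n * of_nat (Suc n) powr (- s)) = alt_series (\<lambda>_. 1) s" by simp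
  have c: "skew_coeff n * of_nat (Suc n) powr (1 - s) = (- 1) ^ n * of_nat (Suc n) powr (- s)" for n
    by (simp only: skew_coeff_def coeff_mult_powr[symmetric] times_divide_eq_left
          times_divide_eq_right mult_1_left mult_1_right)
  have "(s - 1) * (\<Sum>n. skew_harm (Suc n) * of_nat (Suc n) powr (- s)) = P_skew s"
    using kernel_series_eq[OF norm_coeff_le(3) s] by (simp only: sum_skew_coeff c eta P_skew_def)
  hence "(\<Sum>n. skew_harm (Suc n) * of_nat (Suc n) powr (- s)) = P_skew s / (s - 1)"
    using s1 by (simp add: field_simps del: of_nat_Suc)
  moreover have "summable (\<lambda>n. skew_harm (Suc n) * of_nat (Suc n) powr (- s) :: complex)"
    by (intro summable_harm_dominated norm_skew_harm_le s)
  ultimately show "(\<lambda>n. skew_harm (Suc n) / of_nat (Suc n) powr s) sums (P_skew s / (s - 1))"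
    by (simp only: sums_iff div simp_thms)

  have "summable (\<lambda>n. ((- 1) ^ n * harm (Suc n)) * of_nat (Suc n) powr (- s) :: complex)"
    by (intro summable_harm_dominated s)
       (simp only: norm_mult norm_power norm_minus_cancel norm_one power_one mult_1 norm_harm_le)
  hence "(\<lambda>n. (- 1) ^ n * harm (Suc n) * of_nat (Suc n) powr (- s) :: complex)
          sums (\<Sum>n. (- 1) ^ n * harm (Suc n) * of_nat (Suc n) powr (- s))"
    by (rule summable_sums)
  with alt_series_eqI[OF this] show "(\<lambda>n. (- 1) ^ n * harm (Suc n) / of_nat (Suc n) powr s) sums P_alt s"
    by (simp only: P_alt_def div)
qed

section \<open>Harmonic number identities and pairing of terms\<close>

text \<open>Changing the sign of the terms with even denominator subtracts them twice, and twice the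
  sum of \<open>1 / (2 * k)\<close> for \<open>k\<close> up to \<open>n\<close> is
  \<open>harm n\<close>.\<close>

lemma skew_harm_even: "skew_harm (2 * n) = harm (2 * n) - harm n"
proof (induction n)
  case (Suc n)
  have "2 * Suc n = Suc (Suc (2 * n))" by simp
  moreover have "inverse (of_nat (Suc n)) = (2 * inverse (of_nat (Suc (Suc (2 * n)))) :: complex)"
  proof -
    have "(of_nat (Suc (Suc (2 * n))) :: complex) = 2 * of_nat (Suc n)" by simp
    thus ?thesis by (simp only: inverse_mult_distrib) simp
  qed
  ultimately show ?case
    by (simp only: skew_harm_Suc harm_Suc Suc.IH) (simp add: divide_inverse del: of_nat_Suc)
qed (simp_all add: skew_harm_def harm_def)

text \<open>Terms with even denominator cancel, the others double, and
  \<open>2 / (2 * k + 1)\<close> is \<open>1 / (k + 1 / 2)\<close>.\<close>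

lemma harm_add_skew_harm_odd:
  "harm (Suc (2 * n)) + skew_harm (Suc (2 * n)) = shifted_harm n (1 / 2)"
proof (induction n)
  case (Suc n)
  have "2 * Suc n = Suc (Suc (2 * n))" by simp
  moreover have "shifted_harm (Suc n) (1 / 2)
                   = shifted_harm n (1 / 2) + 2 * inverse (of_nat (Suc (Suc (Suc (2 * n)))))"
  proof -
    have "(of_nat (Suc n) + 1 / 2 :: complex) = of_nat (Suc (Suc (Suc (2 * n)))) / 2"
      by (simp add: field_simps)
    hence "1 / (of_nat (Suc n) + 1 / 2 :: complex) = 2 * inverse (of_nat (Suc (Suc (Suc (2 * n)))))"
      by (simp only: divide_divide_eq_right) (simp only: divide_inverse mult_1)
    thus ?thesis by (simp only: shifted_harm_def sum.atLeast0_atMost_Suc)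
  qed
  ultimately show ?case
    by (simp only: skew_harm_Suc harm_Suc Suc.IH[symmetric])
       (simp add: inverse_eq_divide del: of_nat_Suc)
qed (simp_all add: skew_harm_def harm_def shifted_harm_def)

lemma sums_half:
  fixes s :: complex
  assumes s: "Re s > 1"
  shows "(\<lambda>n. shifted_harm n (1 / 2) / (of_nat n + 1 / 2) powr s) sums
           (P_H s / (s - 1) ^ 2 + 2 powr s * (P_alt s + P_skew s / (s - 1)))"
proof -
  define h where "h = (\<lambda>n. harm (Suc n) / of_nat (Suc n) powr s)"
  define k where "k = (\<lambda>n. skew_harm (Suc n) / of_nat (Suc n) powr s)"
  have pair: "(\<lambda>n. f (2 * n) + f (Suc (2 * n))) sums S" if "f sums S" for f :: "nat \<Rightarrow> complex" and S
    using sums_group[OF that, of 2] by (simp add: mult.commute)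
  have "(\<lambda>n. (- 1) ^ n * h n) sums P_alt s"
    using sums_alt[OF s] by (simp add: h_def)
  note alt = pair[OF this]
  have "k sums (P_skew s / (s - 1))"
    using sums_skew[OF s] by (simp add: k_def)
  note skew = pair[OF this]
  have "h sums (P_H s / (s - 1) ^ 2)"
    using sums_harm[OF s] by (simp add: h_def)
  note sums = sums_add[OF this sums_mult[OF sums_add[OF alt skew], of "2 powr s"]]
  have two: "(2 :: complex) powr s \<noteq> 0" by simp
  \<comment> \<open>Indices start at 0, so \<open>h (2 * n)\<close> belongs to the odd number
    \<open>2 * n + 1\<close>. At the following even number the two copies of
    \<open>h (Suc (2 * n))\<close> cancel; what is left, times \<open>2 powr s\<close>, cancels the
    leading \<open>h n\<close>.\<close>
  have "h n + 2 powr s * (((- 1) ^ (2 * n) * h (2 * n) + (- 1) ^ Suc (2 * n) * h (Suc (2 * n)))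
                          + (k (2 * n) + k (Suc (2 * n))))
         = shifted_harm n (1 / 2) / (of_nat n + 1 / 2) powr s" for n
  proof -
    let ?N = "of_nat (Suc (2 * n)) :: complex"
    \<comment> \<open>Complex powers are multiplicative for nonnegative real factors, hence the
      detour through \<open>of_real\<close>.\<close>
    have "?N = 2 * of_real (real n + 1 / 2)" by simp
    also have "\<dots> powr s = 2 powr s * of_real (real n + 1 / 2) powr s"
      by (rule powr_times_real) simp_all
    finally have odd: "?N powr s = 2 powr s * (of_nat n + 1 / 2) powr s"
      by simp
    have "of_nat (Suc (Suc (2 * n))) = 2 * (of_nat (Suc n) :: complex)" by simp
    also have "\<dots> powr s = 2 powr s * of_nat (Suc n) powr s"
      by (rule powr_times_real) simp_all
    finally have even: "of_nat (Suc (Suc (2 * n))) powr s = 2 powr s * (of_nat (Suc n) :: complex) powr s" .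
    have "k (Suc (2 * n)) = h (Suc (2 * n)) - harm (Suc n) / of_nat (Suc (Suc (2 * n))) powr s"
      using skew_harm_even[of "Suc n"] by (simp add: k_def h_def diff_divide_distrib del: of_nat_Suc)
    also have "harm (Suc n) / of_nat (Suc (Suc (2 * n))) powr s = h n / 2 powr s"
      unfolding even by (simp add: h_def field_simps del: of_nat_Suc)
    finally have k: "k (Suc (2 * n)) = h (Suc (2 * n)) - h n / 2 powr s" .
    have "h (2 * n) + k (2 * n) = shifted_harm n (1 / 2) / ?N powr s"
      unfolding h_def k_def harm_add_skew_harm_odd[symmetric] by (rule add_divide_distrib[symmetric])
    also have "2 powr s * \<dots> = shifted_harm n (1 / 2) / (of_nat n + 1 / 2) powr s"
      unfolding odd using two by simp
    finally show ?thesis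
      unfolding k using two by (simp add: algebra_simps)
  qed
  with sums show ?thesis by (simp only:)
qed

section \<open>Laurent coefficients of the continuation\<close>

text \<open>The quotient of \<open>P\<close> by \<open>(s - 1) ^ n\<close> witnesses that a
  continuation exists, and by the identity theorem every continuation agrees with it near 1.
  Dividing by \<open>(s - 1) ^ n\<close> shifts the Taylor index from \<open>m\<close> to
  \<open>m + n\<close>.\<close>

lemma laurent_const_mero_continuation:
  assumes P: "P holomorphic_on {s. Re s > 0}"
    and fps: "(\<lambda>x. P (1 + x)) has_fps_expansion Q"
    and eq: "\<And>s. Re s > 1 \<Longrightarrow> f s = P s / (s - 1) ^ n"
  shows "laurent_const (mero_continuation f) m = (- 1) ^ m * fact m * fps_nth Q (m + n)"
proof -
  define A where "A = {s :: complex. Re s > 0}"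
  define G where "G = (\<lambda>s. P s / (s - 1) ^ n)"
  define F where "F = mero_continuation f"
  have A: "open A" "connected A"
    unfolding A_def by (auto intro: open_halfspace_Re_gt convex_connected convex_halfspace_Re_gt)
  have P_ana: "P analytic_on A"
    using P A by (simp add: analytic_on_open A_def)
  have G: "G meromorphic_on A"
    unfolding G_def using P_ana
    by (intro meromorphic_on_divide analytic_on_imp_meromorphic_on analytic_on_power
          analytic_on_diff analytic_on_ident analytic_on_const)
  \<comment> \<open>Removing singularities makes \<open>G\<close> nicely meromorphic and keeps its
    values at points of analyticity, in particular for \<open>Re s > 1\<close>.\<close>
  have "remove_sings G s = f s" if s: "Re s > 1" for s
  proof -
    have "P analytic_on {s}"
      by (rule analytic_on_subset[OF P_ana]) (use s in \<open>auto simp: A_def\<close>)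
    hence "G analytic_on {s}"
      unfolding G_def using s
      by (intro analytic_on_divide analytic_on_power analytic_on_diff analytic_on_ident
            analytic_on_const) auto
    thus ?thesis using eq[OF s] by (simp add: G_def)
  qed
  hence "\<exists>F. F nicely_meromorphic_on A \<and> (\<forall>s. Re s > 1 \<longrightarrow> F s = f s)"
    using remove_sings_nicely_meromorphic[OF G] by blast
  from someI_ex[OF this] have F: "F nicely_meromorphic_on A" "\<And>s. Re s > 1 \<Longrightarrow> F s = f s"
    unfolding F_def mero_continuation_def A_def by simp_all
  have "(\<lambda>s. F s - G s) meromorphic_on A"
    using F(1) G by (intro meromorphic_on_diff) (auto simp: nicely_meromorphic_on_def)
  from meromorphic_imp_constant_or_avoid[OF this A, of 0]
  have "(\<forall>s\<in>A. eventually (\<lambda>s. F s - G s = 0) (at s)) \<or>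
        (\<forall>s\<in>A. eventually (\<lambda>s. F s - G s \<noteq> 0) (at s))"
    using A by (simp add: eventually_cosparse_open_eq)
  \<comment> \<open>The point 2 is interior to \<open>Re s > 1\<close>, where \<open>F\<close> and
    \<open>G\<close> coincide; this excludes the second alternative.\<close>
  moreover have "\<not>eventually (\<lambda>s. F s - G s \<noteq> 0) (at 2)"
  proof
    assume "eventually (\<lambda>s. F s - G s \<noteq> 0) (at 2)"
    moreover have "eventually (\<lambda>s. s \<in> {s. Re s > 1}) (at (2 :: complex))"
      by (intro eventually_at_in_open' open_halfspace_Re_gt) auto
    ultimately have "eventually (\<lambda>_. False) (at (2 :: complex))"
      by eventually_elim (use F(2) eq in \<open>auto simp: G_def\<close>)
    thus False by simp
  qed
  ultimately have "eventually (\<lambda>s. F s - G s = 0) (at 1)"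
    by (auto simp: A_def)
  hence "laurent_expansion F 1 = laurent_expansion G 1"
    by (intro laurent_expansion_cong) (auto elim: eventually_mono)
  also have "\<dots> = fls_shift (int n) (fps_to_fls Q)"
  proof (rule laurent_expansion_eqI)
    have "(\<lambda>x. P (1 + x) * x powi (- int n)) has_laurent_expansion fls_shift (int n) (fps_to_fls Q)"
      by (intro has_laurent_expansion_shift' has_laurent_expansion_fps fps)
    thus "(\<lambda>x. G (1 + x)) has_laurent_expansion fls_shift (int n) (fps_to_fls Q)"
      by (simp add: G_def power_int_minus divide_inverse)
  qed
  finally show ?thesis
    by (simp add: laurent_const_def F_def nat_add_distrib)
qed

section \<open>Comparison of coefficients\<close>

theorem proposition12:
  fixes m :: nat
  shows "gamma_H m (1 / 2) =
           gamma_H m 1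
           + 2 * (- 1) ^ m * complex_of_real (ln 2) ^ (m + 2) / of_nat (m + 1)
           + 2 * (\<Sum>k=0..m. of_nat (m choose k) * (- complex_of_real (ln 2)) ^ (m - k)
                    * (gamma_H_alt k + gamma_H_skew k))"
proof -
  define L where "L = complex_of_real (ln 2)"
  define H A S where "H = fps_expansion P_H 1" and "A = fps_expansion P_alt 1"
    and "S = fps_expansion P_skew 1"
  define P where "P = (\<lambda>s. P_H s + (s - 1) * (2 powr s * ((s - 1) * P_alt s + P_skew s)))"
  define E where "E = fps_const 2 * fps_exp L"
  define Q where "Q = H + fps_X * (E * (fps_X * A + S))"

  have "f analytic_on {1}" if "f holomorphic_on {s. Re s > 0}" for f
    using that open_halfspace_Re_gt[of 0] by (intro holomorphic_on_imp_analytic_at) auto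
  note ana = this[OF holomorphic_numerators(1)] this[OF holomorphic_numerators(2)]
             this[OF holomorphic_numerators(3)]
  have fps: "(\<lambda>x. P_H (1 + x)) has_fps_expansion H" "(\<lambda>x. P_alt (1 + x)) has_fps_expansion A"
    "(\<lambda>x. P_skew (1 + x)) has_fps_expansion S"
    unfolding H_def A_def S_def by (intro analytic_at_imp_has_fps_expansion ana)+
  have "(\<lambda>x. P_H (1 + x) + x * (2 * exp (L * x) * (x * P_alt (1 + x) + P_skew (1 + x))))
          has_fps_expansion Q"
    unfolding Q_def E_def by (intro fps_expansion_intros fps)
  moreover have "2 powr (1 + x) = 2 * exp (L * x)" for x
  proof -
    have "Ln 2 = L" using Ln_of_real[of 2] by (simp add: L_def)
    hence "(2 :: complex) powr x = exp (L * x)" by (simp add: powr_def mult.commute)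
    thus ?thesis by (simp add: powr_add)
  qed
  ultimately have P_fps: "(\<lambda>x. P (1 + x)) has_fps_expansion Q"
    by (simp add: P_def)

  have H: "gamma_H m 1 = (- 1) ^ m * fact m * fps_nth H (m + 2)"
    unfolding gamma_H_def zeta_H_def
  proof (rule laurent_const_mero_continuation[OF holomorphic_numerators(1) fps(1)])
    fix s :: complex assume "Re s > 1"
    moreover have "shifted_harm n 1 = harm (Suc n)" for n
      by (simp only: harm_altdef shifted_harm_def lessThan_Suc_atMost)
         (simp add: atLeast0AtMost field_simps)
    ultimately show "(\<Sum>n. shifted_harm n 1 / (of_nat n + 1) powr s) = P_H s / (s - 1) ^ 2"
      using sums_harm[of s] by (simp add: sums_iff add.commute)
  qed
  have alt: "gamma_H_alt k = (- 1) ^ k * fact k * fps_nth A k" for k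
    unfolding gamma_H_alt_def zeta_H_alt_def
    using laurent_const_mero_continuation[OF holomorphic_numerators(3) fps(2), of _ 0] sums_alt
    by (simp add: sums_iff)
  have skew: "gamma_H_skew k = (- 1) ^ k * fact k * fps_nth S (Suc k)" for k
    unfolding gamma_H_skew_def zeta_H_skew_def
    using laurent_const_mero_continuation[OF holomorphic_numerators(2) fps(3), of _ 1] sums_skew
    by (simp add: sums_iff)
  have half: "gamma_H m (1 / 2) = (- 1) ^ m * fact m * fps_nth Q (m + 2)"
    unfolding gamma_H_def zeta_H_def
  proof (rule laurent_const_mero_continuation[OF _ P_fps])
    show "P holomorphic_on {s. Re s > 0}"
      unfolding P_def
      by (intro holomorphic_on_add holomorphic_on_mult holomorphic_on_diff holomorphic_on_const
            holomorphic_on_ident holomorphic_on_powr_right holomorphic_numerators)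
    fix s :: complex assume s: "Re s > 1"
    hence "s - 1 \<noteq> 0" by auto
    thus "(\<Sum>n. shifted_harm n (1 / 2) / (of_nat n + 1 / 2) powr s) = P s / (s - 1) ^ 2"
      unfolding sums_unique[OF sums_half[OF s], symmetric] P_def
      by (simp add: divide_simps power2_eq_square)
  qed

  define T where "T = fps_X * A + S"
  have T0: "fps_nth T 0 = L"
    using has_fps_expansion_imp_0_eq_fps_nth_0[OF fps(3)] P_skew_1 by (simp add: T_def L_def)
  have TS: "fps_nth T (Suc k) = fps_nth A k + fps_nth S (Suc k)" for k
    by (simp add: T_def)
  have E_nth: "fps_nth E j = 2 * L ^ j / fact j" for j
    by (simp add: E_def)
  have "fps_nth Q (m + 2) = fps_nth H (m + 2) + fps_nth (T * E) (Suc m)"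
    by (simp add: Q_def T_def mult.commute)
  \<comment> \<open>Splitting off index 0 of the Cauchy product isolates the residue; its factor
    \<open>L\<close> raises \<open>L ^ (m + 1)\<close> to \<open>L ^ (m + 2)\<close>.\<close>
  also have "fps_nth (T * E) (Suc m)
      = fps_nth T 0 * fps_nth E (Suc m) + (\<Sum>k=0..m. fps_nth T (Suc k) * fps_nth E (m - k))"
    by (simp only: fps_mult_nth sum.atLeast0_atMost_Suc_shift) simp
  finally have Q: "fps_nth Q (m + 2) = fps_nth H (m + 2) + (2 * L ^ (m + 2) / fact (Suc m)
      + (\<Sum>k=0..m. (fps_nth A k + fps_nth S (Suc k)) * (2 * L ^ (m - k) / fact (m - k))))"
    by (simp only: T0 TS E_nth) (simp add: mult_ac del: fact_Suc)
  have summand: "(- 1) ^ m * fact m * ((fps_nth A k + fps_nth S (Suc k)) * (2 * L ^ (m - k) / fact (m - k)))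
      = 2 * (of_nat (m choose k) * (- L) ^ (m - k) * (gamma_H_alt k + gamma_H_skew k))"
    if k: "k \<in> {0..m}" for k
  proof -
    \<comment> \<open>One part of the sign turns \<open>L\<close> into \<open>- L\<close>, the other
      enters the constants of index \<open>k\<close>; the factorials are divided up likewise,
      leaving the binomial coefficient.\<close>
    have sign: "(- 1) ^ m = ((- 1) ^ (m - k) * (- 1) ^ k :: complex)"
      using k by (simp flip: power_add)
    have fact: "(fact m :: complex) = of_nat (m choose k) * fact k * fact (m - k)"
      using k by (simp add: binomial_fact)
    show ?thesis
      unfolding sign fact alt skew power_minus[of L] by (simp add: field_simps)
  qed
  have "gamma_H m (1 / 2) = gamma_H m 1 + (- 1) ^ m * fact m * (2 * L ^ (m + 2) / fact (Suc m))
      + (\<Sum>k=0..m. (- 1) ^ m * fact m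
           * ((fps_nth A k + fps_nth S (Suc k)) * (2 * L ^ (m - k) / fact (m - k))))"
    by (simp only: half H Q distrib_left sum_distrib_left add.assoc)
  also have "(\<Sum>k=0..m. (- 1) ^ m * fact m
           * ((fps_nth A k + fps_nth S (Suc k)) * (2 * L ^ (m - k) / fact (m - k))))
      = 2 * (\<Sum>k=0..m. of_nat (m choose k) * (- L) ^ (m - k) * (gamma_H_alt k + gamma_H_skew k))"
    unfolding sum_distrib_left by (rule sum.cong[OF refl summand])
  also have "(- 1) ^ m * fact m * (2 * L ^ (m + 2) / fact (Suc m))
      = 2 * (- 1) ^ m * L ^ (m + 2) / of_nat (m + 1)"
    by (simp add: field_simps del: of_nat_Suc)
  finally show ?thesis by (simp only: L_def)
qed

end
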